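(* Let $n\ge1$ and, for each $i\in\{1,\dots,n\}$, let $E^i$ be a nonempty convex compact subset of a Hausdorff locally convex topological vector space $X_i$, and let $D^i\subseteq E^i$ be a self segment-dense subset of $E^i$. Let $E=\prod_{i=1}^nE^i$, $\widehat{E}^i=\prod_{j\ne i}E^j$, $\widehat{D}^i=\prod_{j\neq i}D^j$, and let $f^i:E\to\mathbb{R}$, $i\in\{1,\dots,n\}$, be functions (the loss functions of the players). Assume that for every $i\in\{1,\dots,n\}$: (i) $f^i$ is lower semicontinuous on $E$; (ii) for all $y^i\in D^i$, the map $\widehat{x}^i\mapsto f^i(y^i,\widehat{x}^i)$ is upper semicontinuous on $\widehat{E}^i$; (iii) for all $\widehat{x}^i\in\widehat{E}^i$, the map $y^i\mapsto f^i(y^i,\widehat{x}^i)$ is upper semicontinuous on $E^i\setminus D^i$; (iv) for all $\widehat{x}^i\in\widehat{D}^i$, the map $y^i\mapsto f^i(y^i,\widehat{x}^i)$ is convex on $D^i$. Then there exists a non-cooperative (Nash) equilibrium.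
   Context: For $x=(x^1,\dots,x^n)\in E$ write $\widehat{x}^i=(x^1,\dots,x^{i-1},x^{i+1},\dots,x^n)\in\widehat{E}^i$ and identify $E=E^i\times\widehat{E}^i$, $x=(x^i,\widehat{x}^i)$. Products carry the product topology. Decision rules: $C^i(\widehat{x}^i)=\{x^i\in E^i: f^i(x^i,\widehat{x}^i)=\inf_{y^i\in E^i}f^i(y^i,\widehat{x}^i)\}$. A non-cooperative (Nash) equilibrium is a fixed point of the set-valued map $C:E\rightrightarrows E$, $C(x)=\prod_{i=1}^nC^i(\widehat{x}^i)$, i.e. a point $x\in E$ with $x^i\in C^i(\widehat{x}^i)$ for all $i$. Self segment-dense: for $U\subseteq V\subseteq X$ with $X$ a topological vector space and $V$ convex, $U$ is self segment-dense in $V$ if $U$ is dense in $V$ (i.e. $V\subseteq\operatorname{cl}(U)$) and for all $x,y\in U$ the set $[x,y]\cap U$ is dense in the closed segment $[x,y]=\{x+t(y-x):t\in[0,1]\}$. A function $g$ is upper (lower) semicontinuous on a subset $S$ of its domain $A$ if, as a function on $A$, it is upper (lower) semicontinuous at each point of $S$. A real function $g$ is convex on a (not necessarily convex) set $D$ if for all $x_1,\dots,x_m\in D$ and $\lambda_k\ge0$ with $\sum_k\lambda_k=1$ and $\sum_k\lambda_kx_k\in D$ one has $g\left(\sum_k\lambda_kx_k\right)\le\sum_k\lambda_kg(x_k)$. *)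

theory Defs
  imports "HOL-Analysis.Analysis"
begin

text \<open>
  Topological vector spaces are given as abstract topologies on linear subspaces of a type of
  class \<open>real_vector\<close>, which itself carries no topology.  This lets a family
  \<open>X\<close> of such spaces vary with its index: any family of real vector spaces embeds, as a family of
  linear subspaces, in a single real vector space (for example its direct sum), and the topologies
  on the members are unrelated to each other.
\<close>

definition tvs :: "'a::real_vector topology \<Rightarrow> bool" where
  "tvs X \<longleftrightarrow>
     subspace (topspace X) \<and>
     continuous_map (prod_topology X X) X (\<lambda>(x, y). x + y) \<and>
     continuous_map (prod_topology euclideanreal X) X (\<lambda>(c, x). c *\<^sub>R x)"

definition locally_convex_tvs :: "'a::real_vector topology \<Rightarrow> bool" where
  "locally_convex_tvs X \<longleftrightarrow> tvs X \<and> neighbourhood_base_at 0 convex X"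

definition self_segment_dense :: "'a::real_vector topology \<Rightarrow> 'a set \<Rightarrow> 'a set \<Rightarrow> bool" where
  "self_segment_dense X U V \<longleftrightarrow>
     U \<subseteq> V \<and> V \<subseteq> topspace X \<and> convex V \<and>
     V \<subseteq> X closure_of U \<and>
     (\<forall>x\<in>U. \<forall>y\<in>U. closed_segment x y \<subseteq> X closure_of (closed_segment x y \<inter> U))"

text \<open>
  Semicontinuity at each point of \<open>S\<close> of a function with domain \<open>topspace T\<close>; the neighbourhoods are
  those of \<open>T\<close>, not of the subspace \<open>S\<close>.
\<close>

definition lsc_on :: "'a topology \<Rightarrow> 'a set \<Rightarrow> ('a \<Rightarrow> real) \<Rightarrow> bool" where
  "lsc_on T S g \<longleftrightarrow>
     S \<subseteq> topspace T \<and> (\<forall>x\<in>S. \<forall>a<g x. eventually (\<lambda>y. a < g y) (nhdsin T x))"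

definition usc_on :: "'a topology \<Rightarrow> 'a set \<Rightarrow> ('a \<Rightarrow> real) \<Rightarrow> bool" where
  "usc_on T S g \<longleftrightarrow>
     S \<subseteq> topspace T \<and> (\<forall>x\<in>S. \<forall>a>g x. eventually (\<lambda>y. g y < a) (nhdsin T x))"

text \<open>
  Unlike \<^const>\<open>convex_on\<close>, the following does not require \<open>D\<close> to be convex, so that convex
  combinations of arbitrary length have to be considered.
\<close>

definition convex_fun_on :: "'a::real_vector set \<Rightarrow> ('a \<Rightarrow> real) \<Rightarrow> bool" where
  "convex_fun_on D g \<longleftrightarrow>
     (\<forall>(m::nat) (x :: nat \<Rightarrow> 'a) (l :: nat \<Rightarrow> real).
        (\<forall>k<m. x k \<in> D \<and> 0 \<le> l k) \<and> (\<Sum>k<m. l k) = 1 \<and> (\<Sum>k<m. l k *\<^sub>R x k) \<in> D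
        \<longrightarrow> g (\<Sum>k<m. l k *\<^sub>R x k) \<le> (\<Sum>k<m. l k * g (x k)))"

text \<open>
  Players are the numbers \<open>1, \<dots>, n\<close>.  Strategy profiles are elements of
  \<open>PiE {1..n} E\<close> and profiles of the opponents of \<open>i\<close> are elements of \<open>PiE (opponents n i) E\<close>.
  The identification of \<open>(y, xh)\<close> with a full profile is \<open>xh(i := y)\<close>.
\<close>

definition opponents :: "nat \<Rightarrow> nat \<Rightarrow> nat set" where
  "opponents n i = {1..n} - {i}"

definition profile_topology ::
    "nat set \<Rightarrow> (nat \<Rightarrow> 'a topology) \<Rightarrow> (nat \<Rightarrow> 'a set) \<Rightarrow> (nat \<Rightarrow> 'a) topology" where
  "profile_topology J X E = product_topology (\<lambda>j. subtopology (X j) (E j)) J"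

text \<open>
  The infimum is taken in the extended reals, so that it is meaningful also for loss functions
  that are not bounded below.
\<close>

definition decision_rule ::
    "(nat \<Rightarrow> 'a set) \<Rightarrow> (nat \<Rightarrow> (nat \<Rightarrow> 'a) \<Rightarrow> real) \<Rightarrow> nat \<Rightarrow> (nat \<Rightarrow> 'a) \<Rightarrow> 'a set" where
  "decision_rule E f i xh =
     {xi \<in> E i. ereal (f i (xh(i := xi))) = (INF yi\<in>E i. ereal (f i (xh(i := yi))))}"

definition decision_map ::
    "nat \<Rightarrow> (nat \<Rightarrow> 'a set) \<Rightarrow> (nat \<Rightarrow> (nat \<Rightarrow> 'a) \<Rightarrow> real) \<Rightarrow> (nat \<Rightarrow> 'a) \<Rightarrow> (nat \<Rightarrow> 'a) set" where
  "decision_map n E f x = (\<Pi>\<^sub>E i\<in>{1..n}. decision_rule E f i (restrict x (opponents n i)))"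

definition nash_equilibrium ::
    "nat \<Rightarrow> (nat \<Rightarrow> 'a set) \<Rightarrow> (nat \<Rightarrow> (nat \<Rightarrow> 'a) \<Rightarrow> real) \<Rightarrow> (nat \<Rightarrow> 'a) \<Rightarrow> bool" where
  "nash_equilibrium n E f x \<longleftrightarrow> x \<in> PiE {1..n} E \<and> x \<in> decision_map n E f x"

end

theory Submission
  imports Defs
begin

text \<open>
  A point \<open>x\<close> is an equilibrium as soon as
  \<open>(\<Sum>i. f i x) \<le> (\<Sum>i. f i (x(i := y i)))\<close> for all \<open>y\<close> in the product of the sets \<open>D i\<close>:
  every own strategy in \<open>E i\<close> can be approximated by one in \<open>D i\<close> without raising the loss by
  more than \<open>\<epsilon>\<close>, so that one may take \<open>y j\<close> almost as good as \<open>x j\<close> for \<open>j \<noteq> i\<close> and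
  an arbitrary deviation for \<open>i\<close>.  For fixed such \<open>y\<close> these inequalities define a closed set
  \<open>G y\<close>, since \<open>f i\<close> is lower semicontinuous and \<open>f i\<close> with own strategy frozen in \<open>D i\<close> is
  upper semicontinuous.  A common point of all \<open>G y\<close> comes from the
  Knaster--Kuratowski--Mazurkiewicz theorem, whose covering condition needs each loss to be convex
  in the own strategy on all of \<open>E i\<close>.  Convexity on \<open>D i\<close> first carries over from opponents in
  \<open>D\<close> to opponents in \<open>E\<close> by density; it then extends to \<open>E i\<close> by semicontinuity, applied to
  two-point combinations only, where a point of a segment determines its coefficients.
\<close>

subsection \<open>The Knaster--Kuratowski--Mazurkiewicz theorem\<close>

lemma tendsto_fun_iff:
  fixes f :: "'c \<Rightarrow> 'i \<Rightarrow> 'b::topological_space"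
  shows "(f \<longlongrightarrow> l) F \<longleftrightarrow> (\<forall>i. ((\<lambda>x. f x i) \<longlongrightarrow> l i) F)"
proof -
  have "limitin (product_topology (\<lambda>i. euclidean) UNIV) f l F \<longleftrightarrow> (\<forall>i. ((\<lambda>x. f x i) \<longlongrightarrow> l i) F)"
    unfolding limitin_componentwise by simp
  then show ?thesis by (simp add: euclidean_product_topology)
qed

text \<open>Pinning the coordinates from \<open>n\<close> on to 0 makes this a compact set of finite
  dimension inside one fixed sequence space, with \<open>n\<close> a variable.\<close>

definition nat_cube :: "nat \<Rightarrow> (nat \<Rightarrow> real) set" where
  "nat_cube n = PiE UNIV (\<lambda>i. if i < n then {0..1} else {0})"

lemma nat_cube_iff: "x \<in> nat_cube n \<longleftrightarrow> (\<forall>i<n. 0 \<le> x i \<and> x i \<le> 1) \<and> (\<forall>i\<ge>n. x i = 0)"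
  unfolding nat_cube_def by (auto simp: PiE_def Pi_def not_less split: if_splits)

lemma compact_nat_cube: "compact (nat_cube n)"
proof -
  have "compactin (product_topology (\<lambda>i. euclidean) UNIV) (nat_cube n)"
    unfolding nat_cube_def compactin_PiE by (auto simp: compactin_euclidean_iff)
  then show ?thesis by (simp add: euclidean_product_topology)
qed

text \<open>
  Brouwer's theorem in the library is stated for Euclidean spaces, whose dimension is fixed by the
  type.  The Knaster--Kuratowski--Mazurkiewicz theorem is needed for an arbitrary number of points,
  hence the cubes of real sequences.
\<close>

lemma kuhn_approx_fixpoint:
  assumes g: "g \<in> nat_cube n \<rightarrow> nat_cube n"
  shows "\<exists>q r s. q \<in> nat_cube n \<and>
    (\<forall>i<n. r i \<in> nat_cube n \<and> s i \<in> nat_cube n \<and> r i i \<le> g (r i) i \<and> g (s i) i \<le> s i i \<and>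
      (\<forall>j. \<bar>r i j - q j\<bar> \<le> 1 / real (Suc p) \<and> \<bar>s i j - q j\<bar> \<le> 1 / real (Suc p)))"
proof -
  let ?P = "Suc p"
  define sc where "sc x = (\<lambda>j. if j < n then real (x j) / real ?P else 0)"
    for x :: "nat \<Rightarrow> nat"
  \<comment> \<open>Label 0 means that \<open>g\<close> does not decrease coordinate
    \<open>i\<close>, label 1 that it does not increase it. The values on the two opposite faces,
    prescribed by Kuhn's lemma, agree with this because \<open>g\<close> maps into the cube.\<close>
  define label where "label x i = (if x i = 0 then 0 else if x i = ?P then 1
      else if sc x i \<le> g (sc x) i then 0 else (1::nat))" for x i
  have sc: "sc x \<in> nat_cube n" if "\<forall>i<n. x i \<le> ?P" for x
    using that by (auto simp: nat_cube_iff sc_def divide_simps)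
  \<comment> \<open>Kuhn's lemma yields one grid cell which has, for every coordinate, two corners
    with different labels.\<close>
  obtain q where q: "\<forall>i<n. q i < ?P" and q': "\<forall>i<n. \<exists>r s. (\<forall>j<n. q j \<le> r j \<and> r j \<le> q j + 1) \<and>
      (\<forall>j<n. q j \<le> s j \<and> s j \<le> q j + 1) \<and> label r i \<noteq> label s i"
    by (rule kuhn_lemma[of ?P n label]) (auto simp: label_def)
  have "\<exists>r s. r \<in> nat_cube n \<and> s \<in> nat_cube n \<and> r i \<le> g r i \<and> g s i \<le> s i \<and>
      (\<forall>j. \<bar>r j - sc q j\<bar> \<le> 1 / real ?P \<and> \<bar>s j - sc q j\<bar> \<le> 1 / real ?P)" if i: "i < n" for i
  proof -
    obtain r s where rs: "\<forall>j<n. q j \<le> r j \<and> r j \<le> q j + 1" "\<forall>j<n. q j \<le> s j \<and> s j \<le> q j + 1"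
      "label r i = 0" "label s i = 1"
    proof -
      obtain r s where *: "\<forall>j<n. q j \<le> r j \<and> r j \<le> q j + 1" "\<forall>j<n. q j \<le> s j \<and> s j \<le> q j + 1"
        "label r i \<noteq> label s i" using q' i by blast
      have "label r i = 0 \<and> label s i = 1 \<or> label s i = 0 \<and> label r i = 1"
        using *(3) unfolding label_def by (auto split: if_splits)
      then show ?thesis using *(1,2) that by blast
    qed
    \<comment> \<open>The strict bound \<open>q j < ?P\<close> keeps the far corners
      \<open>q j + 1\<close> of the cell inside the grid.\<close>
    have rP: "\<forall>j<n. r j \<le> ?P" "\<forall>j<n. s j \<le> ?P"
      using rs(1,2) q by (metis Suc_eq_plus1 Suc_leI le_trans)+
    have gr: "g (sc r) \<in> nat_cube n" "g (sc s) \<in> nat_cube n" using g sc rP by auto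
    have "sc r i \<le> g (sc r) i"
      using rs(3) i gr(1) by (auto simp: label_def nat_cube_iff sc_def split: if_splits)
    moreover have "g (sc s) i \<le> sc s i"
      using rs(4) i gr(2) by (auto simp: label_def nat_cube_iff sc_def split: if_splits)
    moreover have "\<bar>sc r j - sc q j\<bar> \<le> 1 / real ?P" for j
    proof (cases "j < n")
      case True
      then have "real (q j) \<le> real (r j)" "real (r j) \<le> real (q j) + 1"
        using rs(1) by (auto simp: of_nat_le_iff[symmetric] simp del: of_nat_le_iff)
      then show ?thesis by (auto simp: sc_def divide_simps)
    qed (simp add: sc_def)
    moreover have "\<bar>sc s j - sc q j\<bar> \<le> 1 / real ?P" for j
    proof (cases "j < n")
      case True
      then have "real (q j) \<le> real (s j)" "real (s j) \<le> real (q j) + 1"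
        using rs(2) by (auto simp: of_nat_le_iff[symmetric] simp del: of_nat_le_iff)
      then show ?thesis by (auto simp: sc_def divide_simps)
    qed (simp add: sc_def)
    ultimately show ?thesis using sc rP by blast
  qed
  then have "\<forall>i. \<exists>r s. i < n \<longrightarrow> (r \<in> nat_cube n \<and> s \<in> nat_cube n \<and> r i \<le> g r i \<and> g s i \<le> s i \<and>
      (\<forall>j. \<bar>r j - sc q j\<bar> \<le> 1 / real ?P \<and> \<bar>s j - sc q j\<bar> \<le> 1 / real ?P))" by blast
  then obtain r s where "\<forall>i<n. (r i \<in> nat_cube n \<and> s i \<in> nat_cube n \<and> r i i \<le> g (r i) i
      \<and> g (s i) i \<le> s i i \<and>
      (\<forall>j. \<bar>r i j - sc q j\<bar> \<le> 1 / real ?P \<and> \<bar>s i j - sc q j\<bar> \<le> 1 / real ?P))"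
    unfolding choice_iff by blast
  moreover have "sc q \<in> nat_cube n" using sc q by (simp add: less_imp_le)
  ultimately show ?thesis by blast
qed

text \<open>By compactness the approximate fixed points \<open>q p\<close> have a limit point
  \<open>c\<close>. The points \<open>r p i\<close> and \<open>s p i\<close> follow along the same
  subsequence, so in the limit their two inequalities squeeze \<open>g c i\<close> to
  \<open>c i\<close>.\<close>

theorem brouwer_nat_cube:
  assumes cont: "continuous_on (nat_cube n) g" and g: "g \<in> nat_cube n \<rightarrow> nat_cube n"
  shows "\<exists>x\<in>nat_cube n. g x = x"
proof -
  obtain q r s where q: "\<And>p. q p \<in> nat_cube n"
    and rs: "\<And>p i. i < n \<Longrightarrow> r p i \<in> nat_cube n \<and> s p i \<in> nat_cube n \<and> r p i i \<le> g (r p i) i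
        \<and> g (s p i) i \<le> s p i i"
    and near: "\<And>p i j. i < n \<Longrightarrow> \<bar>r p i j - q p j\<bar> \<le> 1 / real (Suc p) \<and> \<bar>s p i j - q p j\<bar> \<le> 1 / real (Suc p)"
    using kuhn_approx_fixpoint[OF g] by metis
  obtain c h where c: "c \<in> nat_cube n" "strict_mono (h::nat\<Rightarrow>nat)" "(q \<circ> h) \<longlonglongrightarrow> c"
    using compact_nat_cube[of n] q unfolding compact_eq_seq_compact_metric seq_compact_def by metis
  have small: "(\<lambda>p. 1 / real (Suc (h p))) \<longlonglongrightarrow> 0"
    using LIMSEQ_subseq_LIMSEQ[OF LIMSEQ_inverse_real_of_nat c(2)]
    by (simp add: o_def inverse_eq_divide)
  have lim: "(\<lambda>p. u (h p)) \<longlonglongrightarrow> c"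
    if "\<And>p j. \<bar>u p j - q p j\<bar> \<le> 1 / real (Suc p)" for u
    unfolding tendsto_fun_iff
  proof
    fix j
    have "(\<lambda>p. u (h p) j - q (h p) j) \<longlonglongrightarrow> 0"
      by (rule Lim_null_comparison[OF _ small]) (use that in auto)
    moreover have "(\<lambda>p. q (h p) j) \<longlonglongrightarrow> c j"
      using c(3) unfolding tendsto_fun_iff by simp
    ultimately show "(\<lambda>p. u (h p) j) \<longlonglongrightarrow> c j"
      using tendsto_add by fastforce
  qed
  have glim: "(\<lambda>p. g (u (h p)) i) \<longlonglongrightarrow> g c i"
    if "\<And>p j. \<bar>u p j - q p j\<bar> \<le> 1 / real (Suc p)" "\<And>p. u p \<in> nat_cube n"
      for u i
    using continuous_on_tendsto_compose[OF cont lim[OF that(1)] c(1)] that(2)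
    unfolding tendsto_fun_iff by simp
  have "g c i = c i" for i
  proof (cases "i < n")
    case True
    have "c i \<le> g c i"
    proof (rule LIMSEQ_le)
      show "(\<lambda>p. r (h p) i i) \<longlonglongrightarrow> c i"
        using lim[of "\<lambda>p. r p i"] near True unfolding tendsto_fun_iff by simp
      show "(\<lambda>p. g (r (h p) i) i) \<longlonglongrightarrow> g c i"
        by (rule glim) (use near rs True in auto)
    qed (use rs True in auto)
    moreover have "g c i \<le> c i"
    proof (rule LIMSEQ_le)
      show "(\<lambda>p. s (h p) i i) \<longlonglongrightarrow> c i"
        using lim[of "\<lambda>p. s p i"] near True unfolding tendsto_fun_iff by simp
      show "(\<lambda>p. g (s (h p) i) i) \<longlonglongrightarrow> g c i"
        by (rule glim) (use near rs True in auto)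
    qed (use rs True in auto)
    ultimately show ?thesis by simp
  next
    case False
    then show ?thesis using c(1) g by (auto simp: nat_cube_iff Pi_iff)
  qed
  then show ?thesis using c(1) by blast
qed

section \<open>The covering theorem on the standard simplex\<close>

definition nat_simplex :: "nat \<Rightarrow> (nat \<Rightarrow> real) set" where
  "nat_simplex m = {l. (\<forall>k<m. 0 \<le> l k) \<and> (\<forall>k\<ge>m. l k = 0) \<and> (\<Sum>k<m. l k) = 1}"

lemma nat_simplex_subset_cube: "nat_simplex m \<subseteq> nat_cube m"
proof
  fix l assume l: "l \<in> nat_simplex m"
  have "l k \<le> 1" if "k < m" for k
    using member_le_sum[of k "{..<m}" l] l that by (auto simp: nat_simplex_def)
  then show "l \<in> nat_cube m" using l by (auto simp: nat_cube_iff nat_simplex_def)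
qed

lemma closed_nat_simplex: "closed (nat_simplex m)"
proof -
  have "nat_simplex m = (\<Inter>k\<in>{..<m}. {l. 0 \<le> l k}) \<inter> (\<Inter>k\<in>{m..}. {l. l k = 0}) \<inter> {l. (\<Sum>k<m. l k) = 1}"
    by (auto simp: nat_simplex_def)
  also have "closed \<dots>"
    by (intro closed_Int closed_INT ballI closed_Collect_le closed_Collect_eq continuous_intros
        continuous_on_product_coordinates)
  finally show ?thesis .
qed

text \<open>Without a common point the distances to the sets \<open>F k\<close> never vanish
  simultaneously, so normalising them gives a continuous self-map \<open>t\<close> of the simplex.
  At a fixed point \<open>l\<close> of \<open>t\<close> the covering condition gives
  \<open>k\<close> with \<open>0 < l k\<close> and \<open>l\<close> in \<open>F k\<close>, yet then
  the distance, and with it \<open>l k\<close>, is 0.\<close>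

theorem kkm:
  assumes closed: "\<And>k. k < m \<Longrightarrow> closed (F k)"
    and cover: "\<And>l. l \<in> nat_simplex m \<Longrightarrow> \<exists>k<m. 0 < l k \<and> l \<in> F k"
    and "0 < m"
  shows "\<exists>l\<in>nat_simplex m. \<forall>k<m. l \<in> F k"
proof (rule ccontr)
  assume "\<not> ?thesis"
  then have no: "\<exists>k<m. l \<notin> F k" if "l \<in> nat_simplex m" for l using that by blast
  \<comment> \<open>Each vertex lies in its own set. Nonemptiness matters because
    \<open>infdist\<close> to the empty set is 0 by convention.\<close>
  have ne: "F k \<noteq> {}" if k: "k < m" for k
  proof -
    let ?e = "\<lambda>j. if j = k then 1 else 0 :: real"
    have "?e \<in> nat_simplex m" using k by (auto simp: nat_simplex_def)
    from cover[OF this] show ?thesis by (auto split: if_splits)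
  qed
  \<comment> \<open>\<open>r\<close> retracts the cube onto the simplex.\<close>
  define r where "r c k = (if k < m then (c k + max 0 (1 - sum c {..<m}) / m) / max 1 (sum c {..<m}) else 0)"
    for c :: "nat \<Rightarrow> real" and k
  have r: "r c \<in> nat_simplex m" if "c \<in> nat_cube m" for c
  proof -
    have "(\<Sum>k<m. r c k) = (\<Sum>k<m. (c k + max 0 (1 - sum c {..<m}) / m)) / max 1 (sum c {..<m})"
      by (simp add: r_def sum_divide_distrib)
    also have "\<dots> = (sum c {..<m} + max 0 (1 - sum c {..<m})) / max 1 (sum c {..<m})"
      using \<open>0 < m\<close> by (simp add: sum.distrib)
    \<comment> \<open>A coordinate sum below 1 has its deficit spread evenly over the
      \<open>m\<close> coordinates and is divided by 1; a larger sum gets no addition and is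
      normalised.\<close>
    also have "\<dots> = 1" by (auto simp: max_def)
    finally have "(\<Sum>k<m. r c k) = 1" .
    moreover have "0 \<le> r c k" for k using that by (auto simp: r_def nat_cube_iff)
    moreover have "r c k = 0" if "m \<le> k" for k using that by (simp add: r_def)
    ultimately show ?thesis by (simp add: nat_simplex_def)
  qed
  have r_id: "r l = l" if "l \<in> nat_simplex m" for l
    using that by (auto simp: r_def nat_simplex_def fun_eq_iff)
  \<comment> \<open>The value 0 from index \<open>m\<close> on makes \<open>t l\<close> vanish
    there, as membership in the simplex demands.\<close>
  define d where "d k l = (if k < m then infdist l (F k) else 0)"
    for k and l :: "nat \<Rightarrow> real"
  define t where "t l k = d k l / (\<Sum>j<m. d j l)" for l k
  have d0: "0 \<le> d k l" for k l by (simp add: d_def infdist_nonneg)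
  have d_pos: "0 < (\<Sum>j<m. d j l)" if l: "l \<in> nat_simplex m" for l
  proof -
    obtain k where k: "k < m" "l \<notin> F k" using no[OF l] by blast
    have "0 < d k l" using infdist_pos_not_in_closed[OF closed ne] k by (simp add: d_def)
    also have "\<dots> \<le> (\<Sum>j<m. d j l)" by (rule member_le_sum) (use k d0 in auto)
    finally show ?thesis .
  qed
  have t: "t l \<in> nat_simplex m" if "l \<in> nat_simplex m" for l
  proof -
    have "t l k = 0" if "m \<le> k" for k using that by (simp add: t_def d_def)
    moreover have "0 \<le> t l k" for k
      unfolding t_def using d0 d_pos[OF that] by (intro divide_nonneg_pos) auto
    moreover have "(\<Sum>k<m. t l k) = 1"
      using d_pos[OF that] by (simp add: t_def sum_divide_distrib[symmetric])
    ultimately show ?thesis by (simp add: nat_simplex_def)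
  qed
  have cr: "continuous_on (nat_cube m) r"
  proof (rule continuous_on_coordinatewise_then_product)
    fix i show "continuous_on (nat_cube m) (\<lambda>c. r c i)"
      unfolding r_def
      by (cases "i < m")
        (auto intro!: continuous_intros continuous_on_subset[OF continuous_on_product_coordinates])
  qed
  have ct: "continuous_on (nat_simplex m) t"
  proof (rule continuous_on_coordinatewise_then_product)
    have cd: "continuous_on (nat_simplex m) (d i)" for i
      by (cases "i < m") (auto simp: d_def[abs_def] intro!: continuous_intros)
    fix i show "continuous_on (nat_simplex m) (\<lambda>l. t l i)"
      unfolding t_def using d_pos
      by (intro continuous_on_divide continuous_on_sum cd) force+
  qed
  have "continuous_on (nat_cube m) (t \<circ> r)"
    by (rule continuous_on_compose[OF cr continuous_on_subset[OF ct]]) (use r in auto)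
  moreover have "t \<circ> r \<in> nat_cube m \<rightarrow> nat_cube m"
    using r t nat_simplex_subset_cube by (auto simp: subset_iff)
  ultimately obtain l where l: "l \<in> nat_cube m" "(t \<circ> r) l = l"
    using brouwer_nat_cube by blast
  \<comment> \<open>The values of \<open>t\<close> on the simplex lie in the simplex, so the fixed
    point does too; \<open>r\<close> is the identity there, and the point is fixed by
    \<open>t\<close> itself.\<close>
  have lS: "l \<in> nat_simplex m" using t[OF r[OF l(1)]] l(2) by simp
  then have tl: "t l = l" using l(2) r_id by simp
  obtain k where k: "k < m" "0 < l k" "l \<in> F k" using cover[OF lS] by blast
  then have "d k l = 0" by (simp add: d_def)
  then have "t l k = 0" by (simp add: t_def)
  then show False using tl k(2) by simp
qed

subsection \<open>Semicontinuity and convexity from self segment-dense sets\<close>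

lemma usc_on_iff_lsc_on_uminus: "usc_on T S g \<longleftrightarrow> lsc_on T S (\<lambda>x. - g x)"
proof -
  have "(\<forall>a>g x. eventually (\<lambda>y. g y < a) F) \<longleftrightarrow> (\<forall>a<(- g x). eventually (\<lambda>y. a < - g y) F)"
    for x F
  proof (intro iffI allI impI)
    fix a assume *: "\<forall>a>g x. eventually (\<lambda>y. g y < a) F" "a < - g x"
    from *(1)[rule_format, of "- a"] *(2) show "eventually (\<lambda>y. a < - g y) F"
      by (simp add: less_minus_iff)
  next
    fix a assume *: "\<forall>a<(- g x). eventually (\<lambda>y. a < - g y) F" "g x < a"
    from *(1)[rule_format, of "- a"] *(2) show "eventually (\<lambda>y. g y < a) F" by simp
  qed
  then show ?thesis by (simp add: usc_on_def lsc_on_def)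
qed

lemma lsc_onE:
  assumes "lsc_on T S g" "x \<in> S" "a < g x"
  obtains U where "openin T U" "x \<in> U" "\<And>y. y \<in> U \<Longrightarrow> a < g y"
proof -
  have "eventually (\<lambda>y. a < g y) (nhdsin T x)" "x \<in> topspace T"
    using assms by (auto simp: lsc_on_def)
  then show ?thesis using that by (auto simp: eventually_nhdsin)
qed

lemma usc_onE:
  assumes "usc_on T S g" "x \<in> S" "g x < a"
  obtains U where "openin T U" "x \<in> U" "\<And>y. y \<in> U \<Longrightarrow> g y < a"
proof -
  have "eventually (\<lambda>y. g y < a) (nhdsin T x)" "x \<in> topspace T"
    using assms by (auto simp: usc_on_def)
  then show ?thesis using that by (auto simp: eventually_nhdsin)
qed

lemma lsc_on_add:
  assumes "lsc_on T S f" "lsc_on T S g"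
  shows "lsc_on T S (\<lambda>x. f x + g x)"
  unfolding lsc_on_def
proof (intro conjI ballI allI impI)
  show "S \<subseteq> topspace T" using assms by (simp add: lsc_on_def)
  fix x a assume x: "x \<in> S" and a: "a < f x + g x"
  define e where "e = (f x + g x - a) / 2"
  have "0 < e" using a by (simp add: e_def)
  then have "eventually (\<lambda>y. f x - e < f y) (nhdsin T x)" "eventually (\<lambda>y. g x - e < g y) (nhdsin T x)"
    using assms x by (simp_all add: lsc_on_def)
  then show "eventually (\<lambda>y. a < f y + g y) (nhdsin T x)"
    by eventually_elim (simp add: e_def field_simps)
qed

lemma lsc_on_const: "S \<subseteq> topspace T \<Longrightarrow> lsc_on T S (\<lambda>x. c)"
  by (simp add: lsc_on_def)

lemma lsc_on_sum:
  assumes "S \<subseteq> topspace T" and "\<And>i. i \<in> I \<Longrightarrow> lsc_on T S (f i)"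
  shows "lsc_on T S (\<lambda>x. \<Sum>i\<in>I. f i x)"
  using assms(2)
  by (induction I rule: infinite_finite_induct) (simp_all add: lsc_on_const lsc_on_add assms(1))

lemma lsc_on_cmult:
  assumes "lsc_on T S f" "0 \<le> c"
  shows "lsc_on T S (\<lambda>x. c * f x)"
proof (cases "c = 0")
  case True
  then show ?thesis using assms by (simp add: lsc_on_def)
next
  case False
  then have c: "0 < c" using assms by simp
  have "eventually (\<lambda>y. a < c * f y) (nhdsin T x)" if "x \<in> S" "a < c * f x" for x a
  proof -
    have "a / c < f x" using that c by (simp add: divide_simps mult.commute)
    then have "eventually (\<lambda>y. a / c < f y) (nhdsin T x)"
      using assms that by (simp add: lsc_on_def)
    then show ?thesis by (rule eventually_mono) (use c in \<open>simp add: divide_simps mult.commute\<close>)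
  qed
  then show ?thesis using assms by (simp add: lsc_on_def)
qed

lemma lsc_on_compose:
  assumes "lsc_on T (topspace T) g" "continuous_map T' T h"
  shows "lsc_on T' (topspace T') (\<lambda>x. g (h x))"
  unfolding lsc_on_def
proof (intro conjI ballI allI impI)
  fix x a assume x: "x \<in> topspace T'" and a: "a < g (h x)"
  have hx: "h x \<in> topspace T" using assms(2) x by (auto simp: continuous_map_def)
  obtain U where U: "openin T U" "h x \<in> U" "\<And>y. y \<in> U \<Longrightarrow> a < g y"
    using lsc_onE[OF assms(1) hx a] by blast
  have "openin T' {x \<in> topspace T'. h x \<in> U}"
    using openin_continuous_map_preimage[OF assms(2) U(1)] .
  then show "eventually (\<lambda>y. a < g (h y)) (nhdsin T' x)"
    unfolding eventually_nhdsin using U x by blast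
qed simp

lemma usc_on_compose:
  assumes "usc_on T (topspace T) g" "continuous_map T' T h"
  shows "usc_on T' (topspace T') (\<lambda>x. g (h x))"
  using assms lsc_on_compose[of T "\<lambda>x. - g x"] by (simp add: usc_on_iff_lsc_on_uminus)

lemma lsc_on_cong:
  assumes "\<And>x. x \<in> topspace T \<Longrightarrow> f x = g x" "lsc_on T S f"
  shows "lsc_on T S g"
proof -
  have "eventually (\<lambda>y. f y = g y) (nhdsin T x)" if "x \<in> S" for x
    using assms that by (auto simp: lsc_on_def eventually_nhdsin intro!: exI[of _ "topspace T"])
  then have "eventually (\<lambda>y. a < g y) (nhdsin T x)" if "x \<in> S" "a < g x" for x a
    using that assms eventually_elim2[of "\<lambda>y. a < f y" "nhdsin T x" "\<lambda>y. f y = g y" "\<lambda>y. a < g y"]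
    by (auto simp: lsc_on_def subset_iff)
  then show ?thesis using assms by (simp add: lsc_on_def)
qed

lemma usc_on_cong:
  assumes "\<And>x. x \<in> topspace T \<Longrightarrow> f x = g x" "usc_on T S f"
  shows "usc_on T S g"
  using assms lsc_on_cong[of T "\<lambda>x. - f x" "\<lambda>x. - g x"]
    by (simp add: usc_on_iff_lsc_on_uminus)

lemma openin_lsc_superlevel:
  assumes "lsc_on T (topspace T) g"
  shows "openin T {x \<in> topspace T. a < g x}"
proof (subst openin_subopen, intro ballI)
  fix x assume x: "x \<in> {x \<in> topspace T. a < g x}"
  then obtain U where U: "openin T U" "x \<in> U" "\<And>y. y \<in> U \<Longrightarrow> a < g y"
    using lsc_onE[OF assms, of x a] by blast
  then show "\<exists>U. openin T U \<and> x \<in> U \<and> U \<subseteq> {x \<in> topspace T. a < g x}"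
    using openin_subset by blast
qed

section \<open>Extending convexity by density\<close>

lemma in_closure_of_meets:
  assumes "x \<in> T closure_of P" "openin T U" "x \<in> U"
  obtains y where "y \<in> P" "y \<in> U"
  using assms unfolding in_closure_of by metis

text \<open>For fixed points and weights, the set of parameters \<open>w\<close> at which the
  convexity inequality fails is open, so if nonempty it would meet the dense set \<open>P\<close>.
  The parameter will be the profile of the opponents.\<close>

lemma convex_fun_on_dense:
  assumes dense: "topspace T \<subseteq> T closure_of P"
    and lsc: "\<And>y. y \<in> D \<Longrightarrow> lsc_on T (topspace T) (\<lambda>w. h w y)"
    and usc: "\<And>y. y \<in> D \<Longrightarrow> usc_on T (topspace T) (\<lambda>w. h w y)"
    and conv: "\<And>w. w \<in> P \<Longrightarrow> convex_fun_on D (h w)"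
    and w: "w \<in> topspace T"
  shows "convex_fun_on D (h w)"
  unfolding convex_fun_on_def
proof (intro allI impI)
  fix m :: nat and x :: "nat \<Rightarrow> 'b" and l :: "nat \<Rightarrow> real"
  let ?z = "\<Sum>k<m. l k *\<^sub>R x k"
  assume *: "(\<forall>k<m. x k \<in> D \<and> 0 \<le> l k) \<and> sum l {..<m} = 1 \<and> ?z \<in> D"
  \<comment> \<open>This is the convexity defect. Its first term uses lower, the negated terms use
    upper semicontinuity in \<open>w\<close>; all points involved lie in \<open>D\<close>.\<close>
  define g where "g w = h w ?z + (\<Sum>k<m. l k * - h w (x k))" for w
  have "lsc_on T (topspace T) g"
    unfolding g_def using * lsc usc
    by (intro lsc_on_add lsc_on_sum lsc_on_cmult) (auto simp: usc_on_iff_lsc_on_uminus)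
  then have op: "openin T {w \<in> topspace T. 0 < g w}" by (rule openin_lsc_superlevel)
  have "g w \<le> 0"
  proof (rule ccontr)
    assume "\<not> ?thesis"
    then have "w \<in> T closure_of P" "w \<in> {w \<in> topspace T. 0 < g w}" using w dense by auto
    then obtain v where v: "v \<in> P" "0 < g v" using in_closure_of_meets[OF _ op] by blast
    have "h v ?z \<le> (\<Sum>k<m. l k * h v (x k))"
      using conv[OF v(1)] * unfolding convex_fun_on_def by blast
    then show False using v(2) by (simp add: g_def sum_negf)
  qed
  then show "h w ?z \<le> (\<Sum>k<m. l k * h w (x k))" by (simp add: g_def sum_negf)
qed

lemma tvs_continuous_map_add:
  assumes X: "tvs X" and u: "continuous_map T X u" and v: "continuous_map T X v"
  shows "continuous_map T X (\<lambda>t. u t + v t)"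
proof -
  have "continuous_map (prod_topology X X) X (\<lambda>(x, y). x + y)"
    using X by (simp add: tvs_def)
  from continuous_map_compose[OF continuous_map_pairedI[OF u v] this]
  show ?thesis by (simp add: o_def)
qed

lemma tvs_continuous_map_scaleR:
  assumes X: "tvs X" and c: "continuous_map T euclideanreal c" and u: "continuous_map T X u"
  shows "continuous_map T X (\<lambda>t. c t *\<^sub>R u t)"
proof -
  have "continuous_map (prod_topology euclideanreal X) X (\<lambda>(c, x). c *\<^sub>R x)"
    using X by (simp add: tvs_def)
  from continuous_map_compose[OF continuous_map_pairedI[OF c u] this]
  show ?thesis by (simp add: o_def)
qed

lemma tvs_continuous_map_sum:
  assumes "tvs X" "\<And>k. k \<in> K \<Longrightarrow> continuous_map T X (u k)"
  shows "continuous_map T X (\<lambda>t. \<Sum>k\<in>K. u k t)"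
  using assms(2)
proof (induction K rule: infinite_finite_induct)
  case (insert k K)
  then show ?case by (simp add: tvs_continuous_map_add[OF assms(1)])
qed (use assms(1) in \<open>simp_all add: tvs_def subspace_0\<close>)

text \<open>At a point of \<open>D\<close> the point itself serves; elsewhere upper semicontinuity
  bounds \<open>g\<close> on a neighbourhood, which density makes meet \<open>D\<close>.\<close>

lemma dense_usc_approx:
  assumes ssd: "self_segment_dense X D E"
    and usc: "usc_on (subtopology X E) (E - D) g"
    and N: "openin (subtopology X E) N" "x \<in> N"
    and e: "0 < e"
  shows "\<exists>y\<in>D. y \<in> N \<and> g y < g x + e"
proof (cases "x \<in> D")
  case True
  then show ?thesis using N e by auto
next
  case False
  have x: "x \<in> E" using N openin_subset by fastforce
  have DE: "D \<subseteq> E" "E \<subseteq> X closure_of D"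
    using ssd by (auto simp: self_segment_dense_def)
  obtain U where U: "openin (subtopology X E) U" "x \<in> U" "\<And>y. y \<in> U \<Longrightarrow> g y < g x + e"
    using usc_onE[OF usc, of x "g x + e"] x False e by auto
  have "openin (subtopology X E) (U \<inter> N)" using U N by auto
  then obtain W where W: "openin X W" "U \<inter> N = W \<inter> E"
    by (auto simp: openin_subtopology)
  have "x \<in> W" using W U N by auto
  moreover have "x \<in> X closure_of D" using x DE by blast
  ultimately obtain y where "y \<in> D" "y \<in> W" using in_closure_of_meets[OF _ W(1)] by blast
  then show ?thesis using W DE U by blast
qed

text \<open>The combination may lie outside \<open>D\<close>. If the inequality failed there, it
  would also fail, by lower semicontinuity, at points of the segment close by; some of these lie in
  \<open>D\<close>, where \<open>g\<close> is convex.\<close>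

lemma convex_on_dense_segment:
  assumes X: "tvs X" "Hausdorff_space X"
    and ssd: "self_segment_dense X D E"
    and lsc: "lsc_on (subtopology X E) E g"
    and conv: "convex_fun_on D g"
    and xy: "x \<in> D" "y \<in> D" and u: "0 \<le> u" "u \<le> 1"
  shows "g (u *\<^sub>R x + (1 - u) *\<^sub>R y) \<le> u * g x + (1 - u) * g y"
proof (cases "x = y")
  case True
  then show ?thesis by (simp add: algebra_simps)
next
  case False
  let ?p = "\<lambda>s. s *\<^sub>R x + (1 - s) *\<^sub>R y"
  let ?h = "\<lambda>s. s * g x + (1 - s) * g y"
  have E: "D \<subseteq> E" "E \<subseteq> topspace X" "convex E"
    and seg: "closed_segment x y \<subseteq> X closure_of (closed_segment x y \<inter> D)"
    using ssd xy by (auto simp: self_segment_dense_def)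
  have inj: "s = t" if "?p s = ?p t" for s t
  proof -
    have "(s - t) *\<^sub>R (x - y) = 0" using that by (simp add: algebra_simps)
    then show ?thesis using False by simp
  qed
  have segE: "?p s \<in> E" if "0 \<le> s" "s \<le> 1" for s
    using that E xy convexD[OF E(3), of x y s "1-s"] by auto
  show ?thesis
  proof (rule ccontr)
    assume "\<not> ?thesis"
    then obtain a where a: "?h u < a" "a < g (?p u)" using dense by (metis not_le)
    \<comment> \<open>\<open>K\<close> holds the parameters whose interpolated value is at least
      \<open>a\<close>. Its image is compact, hence closed in a Hausdorff space, and misses
      \<open>?p u\<close> by injectivity; removing it forces the interpolated value below
      \<open>a\<close> near \<open>?p u\<close>.\<close>
    define K where "K = {s \<in> {0..1}. a \<le> ?h s}"
    have "closed {s. a \<le> ?h s}" by (intro closed_Collect_le continuous_intros)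
    moreover have "K = {0..1} \<inter> {s. a \<le> ?h s}" by (auto simp: K_def)
    ultimately have "compact K" by (simp add: compact_Int_closed)
    moreover have "continuous_map euclideanreal X ?p"
      using xy E by (intro tvs_continuous_map_add[OF X(1)] tvs_continuous_map_scaleR[OF X(1)]
          continuous_map_diff continuous_map_const[THEN iffD2] continuous_map_id[unfolded id_def]) auto
    ultimately have "closedin X (?p ` K)"
      by (intro compactin_imp_closedin[OF X(2)] image_compactin) (auto simp: compactin_euclidean_iff)
    moreover have "openin (subtopology X E) {z \<in> topspace (subtopology X E). a < g z}"
      by (rule openin_lsc_superlevel) (use lsc E in \<open>simp add: inf_absorb2\<close>)
    then obtain W where W: "openin X W" "{z \<in> E. a < g z} = W \<inter> E"
      using E by (auto simp: openin_subtopology inf_absorb2)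
    ultimately have op: "openin X (W - ?p ` K)" by blast
    have "?p u \<in> W" using W(2) a(2) segE u by blast
    moreover have "?p u \<notin> ?p ` K" using inj a(1) unfolding K_def by fastforce
    moreover have "?p u \<in> closed_segment x y" using u
      by (auto simp: closed_segment_def intro!: exI[of _ "1-u"])
    ultimately have pu: "?p u \<in> X closure_of (closed_segment x y \<inter> D)" "?p u \<in> W - ?p ` K"
      using seg by blast+
    obtain z where z: "z \<in> closed_segment x y" "z \<in> D" "z \<in> W" "z \<notin> ?p ` K"
      using in_closure_of_meets[OF pu(1) op pu(2)] by (metis DiffE IntE)
    obtain s where s: "0 \<le> s" "s \<le> 1" "z = ?p s"
    proof -
      obtain v where "0 \<le> v" "v \<le> 1" "z = (1 - v) *\<^sub>R x + v *\<^sub>R y"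
        using z(1) by (auto simp: closed_segment_def)
      then show ?thesis using that[of "1-v"] by simp
    qed
    have "s \<notin> K" using z(4) s(3) by blast
    then have "?h s < a" using s by (auto simp: K_def)
    moreover have "a < g z" using W(2) z E by blast
    moreover have "g z \<le> ?h s"
    proof -
      define xs where "xs k = (if k = 0 then x else y)" for k :: nat
      define l where "l k = (if k = 0 then s else 1 - s)" for k :: nat
      have "(\<forall>k<2. xs k \<in> D \<and> 0 \<le> l k) \<and> sum l {..<2} = 1 \<and> (\<Sum>k<2. l k *\<^sub>R xs k) \<in> D"
        using xy s z(2) by (simp add: xs_def l_def lessThan_nat_numeral add.commute)
      then have "g (\<Sum>k<2. l k *\<^sub>R xs k) \<le> (\<Sum>k<2. l k * g (xs k))"
        using conv unfolding convex_fun_on_def by blast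
      then show ?thesis using s(3) by (simp add: xs_def l_def lessThan_nat_numeral add.commute)
    qed
    ultimately show False by simp
  qed
qed

text \<open>A failure at \<open>x\<close>, \<open>y\<close> in \<open>E\<close> keeps
  \<open>g\<close> above \<open>a\<close> at the combination of all nearby pairs in
  \<open>E\<close>. Such a pair can be taken in \<open>D\<close> with \<open>g\<close> raised by
  less than \<open>e\<close> at each end, which contradicts convexity on segments with ends in
  \<open>D\<close>.\<close>

lemma convex_on_self_segment_dense:
  assumes X: "tvs X" "Hausdorff_space X"
    and ssd: "self_segment_dense X D E"
    and lsc: "lsc_on (subtopology X E) E g"
    and usc: "usc_on (subtopology X E) (E - D) g"
    and conv: "convex_fun_on D g"
  shows "convex_on E g"
proof -
  have E: "D \<subseteq> E" "E \<subseteq> topspace X" "convex E"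
    using ssd by (auto simp: self_segment_dense_def)
  have topE: "topspace (subtopology X E) = E" using E by auto
  have "g (u *\<^sub>R x + (1 - u) *\<^sub>R y) \<le> u * g x + (1 - u) * g y"
    if xy: "x \<in> E" "y \<in> E" and u: "0 \<le> u" "u \<le> 1" for x y u
  proof (rule ccontr)
    let ?z = "u *\<^sub>R x + (1 - u) *\<^sub>R y"
    assume "\<not> ?thesis"
    then obtain a where a: "u * g x + (1 - u) * g y < a" "a < g ?z" using dense by (metis not_le)
    \<comment> \<open>Raising both \<open>g x\<close> and \<open>g y\<close> by this amount brings
      the right-hand side exactly to \<open>a\<close>.\<close>
    define e where "e = a - (u * g x + (1 - u) * g y)"
    have e: "0 < e" using a by (simp add: e_def)
    let ?S = "subtopology X E"
    let ?q = "\<lambda>w. u *\<^sub>R fst w + (1 - u) *\<^sub>R snd w"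
    have "continuous_map (prod_topology ?S ?S) X ?q"
      by (intro tvs_continuous_map_add[OF X(1)] tvs_continuous_map_scaleR[OF X(1)]
          continuous_map_const[THEN iffD2] continuous_map_into_fulltopology[of _ X E]
          continuous_map_fst continuous_map_snd) auto
    moreover have "?q w \<in> E" if "w \<in> topspace (prod_topology ?S ?S)" for w
      using that u E convexD[OF E(3), of "fst w" "snd w" u "1-u"] by auto
    ultimately have q: "continuous_map (prod_topology ?S ?S) ?S ?q"
      by (auto simp: continuous_map_in_subtopology)
    have "openin ?S {z \<in> E. a < g z}"
      using openin_lsc_superlevel[of ?S g a] lsc by (simp only: topE)
    from openin_continuous_map_preimage[OF q this]
    have op: "openin (prod_topology ?S ?S) {w \<in> topspace (prod_topology ?S ?S). ?q w \<in> {z \<in> E. a < g z}}"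
      (is "openin _ ?O") .
    have "(x, y) \<in> ?O" using xy a(2) u E convexD[OF E(3), of x y u "1-u"] by (auto simp: topE)
    from openin_prod_topology_alt[THEN iffD1, rule_format, OF op this]
    obtain Nx Ny where N: "openin ?S Nx" "openin ?S Ny" "x \<in> Nx" "y \<in> Ny"
      and NN: "Nx \<times> Ny \<subseteq> ?O"
      by (elim exE conjE)
    obtain x' where x': "x' \<in> D" "x' \<in> Nx" "g x' < g x + e"
      using dense_usc_approx[OF ssd usc N(1,3) e] by blast
    obtain y' where y': "y' \<in> D" "y' \<in> Ny" "g y' < g y + e"
      using dense_usc_approx[OF ssd usc N(2,4) e] by blast
    have "(x', y') \<in> ?O" using NN x' y' by blast
    then have "a < g (u *\<^sub>R x' + (1 - u) *\<^sub>R y')" by simp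
    also have "\<dots> \<le> u * g x' + (1 - u) * g y'"
      by (rule convex_on_dense_segment[OF X ssd lsc conv x'(1) y'(1) u])
    also have "\<dots> \<le> u * (g x + e) + (1 - u) * (g y + e)"
      using x' y' u by (intro add_mono mult_left_mono) auto
    also have "\<dots> = a" by (simp add: e_def algebra_simps)
    finally show False by simp
  qed
  note conv = this
  show ?thesis
  proof (rule convex_onI)
    fix t :: real and x y assume "0 < t" "t < 1" "x \<in> E" "y \<in> E"
    then show "g ((1 - t) *\<^sub>R x + t *\<^sub>R y) \<le> (1 - t) * g x + t * g y"
      using conv[of x y "1 - t"] by simp
  qed (fact E(3))
qed

subsection \<open>Nash equilibria\<close>

text \<open>The finite intersection property leaves finitely many \<open>y\<close>; the sets
  \<open>G y\<close> are pulled back along \<open>A\<close> to closed subsets of a simplex, where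
  \<open>kkm\<close> applies. \<open>A\<close> stands for forming convex combinations.\<close>

lemma kkm_compact_space:
  assumes T: "compact_space T" and Y: "Y \<noteq> {}"
    and closed: "\<And>y. y \<in> Y \<Longrightarrow> closedin T (G y)"
    and A: "\<And>m ys. \<lbrakk>0 < m; \<And>k. k < m \<Longrightarrow> ys k \<in> Y\<rbrakk> \<Longrightarrow>
      continuous_map (top_of_set (nat_simplex m)) T (A m ys) \<and>
      (\<forall>l\<in>nat_simplex m. \<exists>k<m. 0 < l k \<and> A m ys l \<in> G (ys k))"
  shows "\<exists>x. \<forall>y\<in>Y. x \<in> G y"
proof -
  have "\<Inter>\<F> \<noteq> {}" if fin: "finite \<F>" and sub: "\<F> \<subseteq> G ` Y" for \<F>
  proof (cases "\<F> = {}")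
    case False
    obtain Z where Z: "Z \<subseteq> Y" "finite Z" "\<F> = G ` Z"
      using finite_subset_image[OF fin sub] by blast
    obtain ys where ys: "bij_betw ys {..<card Z} Z"
      using ex_bij_betw_nat_finite[OF Z(2)] by (auto simp: atLeast0LessThan)
    let ?m = "card Z"
    have m: "0 < ?m" using Z False by (simp add: card_gt_0_iff)
    have ysY: "ys k \<in> Y" if "k < ?m" for k using ys Z that by (auto simp: bij_betw_def)
    note A' = A[of ?m ys, OF m ysY]
    have "\<exists>l\<in>nat_simplex ?m. \<forall>k<?m. l \<in> {l \<in> nat_simplex ?m. A ?m ys l \<in> G (ys k)}"
    proof (rule kkm[OF _ _ m])
      fix k assume k: "k < ?m"
      have "closedin (top_of_set (nat_simplex ?m))
          {l \<in> topspace (top_of_set (nat_simplex ?m)). A ?m ys l \<in> G (ys k)}"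
        using A' closed[OF ysY[OF k]] by (intro closedin_continuous_map_preimage) auto
      then show "closed {l \<in> nat_simplex ?m. A ?m ys l \<in> G (ys k)}"
        using closedin_closed_eq[OF closed_nat_simplex] by simp
    next
      fix l assume "l \<in> nat_simplex ?m"
      then show "\<exists>k<?m. 0 < l k \<and> l \<in> {l \<in> nat_simplex ?m. A ?m ys l \<in> G (ys k)}"
        using A' by blast
    qed
    then obtain l where l: "\<forall>k<?m. A ?m ys l \<in> G (ys k)" by blast
    have "A ?m ys l \<in> G z" if "z \<in> Z" for z
      using l ys that unfolding bij_betw_def by (metis imageE lessThan_iff)
    then show ?thesis using Z by blast
  qed simp
  then have "\<Inter>(G ` Y) \<noteq> {}"
    using T[unfolded compact_space_fip, rule_format, of "G ` Y"] closed by blast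
  then show ?thesis by blast
qed

section \<open>Spaces of strategy profiles and equilibria\<close>

lemma topspace_profile_topology:
  assumes "\<And>j. j \<in> J \<Longrightarrow> E j \<subseteq> topspace (X j)"
  shows "topspace (profile_topology J X E) = PiE J E"
  unfolding profile_topology_def topspace_product_topology
  by (rule PiE_cong) (use assms in auto)

text \<open>A constant \<open>u\<close> gives continuity in the opponents' strategies, a constant
  \<open>h\<close> continuity in the own strategy.\<close>

lemma continuous_map_profile_update:
  assumes h: "continuous_map T (profile_topology (opponents n i) X E) h"
    and u: "continuous_map T (subtopology (X i) (E i)) u" and i: "i \<in> {1..n}"
  shows "continuous_map T (profile_topology {1..n} X E) (\<lambda>t. (h t)(i := u t))"
  using assms unfolding profile_topology_def continuous_map_componentwise
  by (auto simp: extensional_def opponents_def)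

lemma continuous_map_profile_restrict:
  assumes "J \<subseteq> I"
  shows "continuous_map (profile_topology I X E) (profile_topology J X E) (\<lambda>x. restrict x J)"
  unfolding profile_topology_def continuous_map_componentwise
  using assms by (auto intro: continuous_map_product_projection)

lemma nash_equilibriumI:
  assumes x: "x \<in> PiE {1..n} E"
    and opt: "\<And>i y. i \<in> {1..n} \<Longrightarrow> y \<in> E i \<Longrightarrow> f i x \<le> f i (x(i := y))"
  shows "nash_equilibrium n E f x"
proof -
  have "x i \<in> decision_rule E f i (restrict x (opponents n i))" if i: "i \<in> {1..n}" for i
  proof -
    have upd: "f i ((restrict x (opponents n i))(i := y)) = f i (x(i := y))" for y
    proof -
      have "(restrict x (opponents n i))(i := y) = x(i := y)"
        using x i by (auto simp: fun_eq_iff opponents_def PiE_def extensional_def)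
      then show ?thesis by simp
    qed
    have xi: "x i \<in> E i" using x i by auto
    have "ereal (f i (x(i := x i))) = (INF y\<in>E i. ereal (f i (x(i := y))))"
      using opt[OF i] xi by (intro antisym INF_greatest INF_lower) auto
    then show ?thesis unfolding decision_rule_def upd using xi by simp
  qed
  then show ?thesis
    using x unfolding nash_equilibrium_def decision_map_def by (auto simp: PiE_def Pi_def)
qed

theorem theorem6p1:
  fixes n :: nat
    and X :: "nat \<Rightarrow> 'a::real_vector topology"
    and E D :: "nat \<Rightarrow> 'a set"
    and f :: "nat \<Rightarrow> (nat \<Rightarrow> 'a) \<Rightarrow> real"
  assumes "n \<ge> 1"
    and "\<And>i. i \<in> {1..n} \<Longrightarrow> locally_convex_tvs (X i) \<and> Hausdorff_space (X i)"
    and "\<And>i. i \<in> {1..n} \<Longrightarrow> E i \<noteq> {} \<and> convex (E i) \<and> compactin (X i) (E i)"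
    and "\<And>i. i \<in> {1..n} \<Longrightarrow> self_segment_dense (X i) (D i) (E i)"
    and "\<And>i. i \<in> {1..n} \<Longrightarrow> lsc_on (profile_topology {1..n} X E) (PiE {1..n} E) (f i)"
    and "\<And>i yi. i \<in> {1..n} \<Longrightarrow> yi \<in> D i \<Longrightarrow>
           usc_on (profile_topology (opponents n i) X E) (PiE (opponents n i) E)
             (\<lambda>xh. f i (xh(i := yi)))"
    and "\<And>i xh. i \<in> {1..n} \<Longrightarrow> xh \<in> PiE (opponents n i) E \<Longrightarrow>
           usc_on (subtopology (X i) (E i)) (E i - D i) (\<lambda>yi. f i (xh(i := yi)))"
    and "\<And>i xh. i \<in> {1..n} \<Longrightarrow> xh \<in> PiE (opponents n i) D \<Longrightarrow>
           convex_fun_on (D i) (\<lambda>yi. f i (xh(i := yi)))"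
  shows "\<exists>x. nash_equilibrium n E f x"
proof -
  note One_nat_def [simp del]
  let ?N = "{1..n}"
  let ?O = "opponents n"
  let ?T = "profile_topology ?N X E"
  let ?To = "\<lambda>i. profile_topology (?O i) X E"
  let ?S = "\<lambda>i. subtopology (X i) (E i)"
  have tvs: "tvs (X i)" and haus: "Hausdorff_space (X i)" and convE: "convex (E i)"
    and ssd: "self_segment_dense (X i) (D i) (E i)" if "i \<in> ?N" for i
    using assms(2-4)[OF that] by (auto simp: locally_convex_tvs_def)
  have DE: "D i \<subseteq> E i" and EX: "E i \<subseteq> topspace (X i)" and EclD: "E i \<subseteq> X i closure_of D i"
    if "i \<in> ?N" for i
    using ssd[OF that] by (auto simp: self_segment_dense_def)
  have topS: "topspace (?S i) = E i" if "i \<in> ?N" for i using EX[OF that] by auto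
  have ON: "?O i \<subseteq> ?N" for i by (auto simp: opponents_def)
  have topT: "topspace ?T = PiE ?N E" by (rule topspace_profile_topology) (use EX in auto)
  have topTo: "topspace (?To i) = PiE (?O i) E" for i
    by (rule topspace_profile_topology) (use EX ON in blast)
  have Dne: "D i \<noteq> {}" if "i \<in> ?N" for i
  proof
    assume "D i = {}"
    then show False using EclD[OF that] assms(3)[OF that] by simp
  qed
  have compT: "compact_space ?T"
    unfolding profile_topology_def compact_space_product_topology
    using assms(3) by (auto intro: compact_space_subtopology)
  have restr: "restrict x (?O i) \<in> PiE (?O i) E" if "x \<in> PiE ?N E" for x i
    using that ON by auto
  have upd: "(restrict x (?O i))(i := y) = x(i := y)" if "x \<in> PiE ?N E" "i \<in> ?N" for x i y
    using that by (auto simp: fun_eq_iff opponents_def PiE_def extensional_def)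
  have lscT: "lsc_on ?T (topspace ?T) (f i)" if "i \<in> ?N" for i
    unfolding topT by (rule assms(5)[OF that])
  have lsc_y: "lsc_on (?To i) (PiE (?O i) E) (\<lambda>w. f i (w(i := y)))"
    if i: "i \<in> ?N" and y: "y \<in> E i" for i y
  proof -
    have "continuous_map (?To i) ?T (\<lambda>w. w(i := y))"
      by (rule continuous_map_profile_update[OF _ _ i])
        (use y topS[OF i] in \<open>auto simp del: topspace_subtopology\<close>)
    from lsc_on_compose[OF lscT[OF i] this] show ?thesis unfolding topTo .
  qed
  have lsc_w: "lsc_on (?S i) (E i) (\<lambda>y. f i (w(i := y)))"
    if i: "i \<in> ?N" and w: "w \<in> PiE (?O i) E" for i w
  proof -
    have "continuous_map (?S i) ?T (\<lambda>y. w(i := y))"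
      by (rule continuous_map_profile_update[OF _ _ i])
        (use w topTo[of i] in auto)
    from lsc_on_compose[OF lscT[OF i] this] show ?thesis unfolding topS[OF i] .
  qed
  \<comment> \<open>For own strategies in \<open>D i\<close> the loss is continuous in the
    opponents, by (i) and (ii). Closures of products are products of closures, so the opponents'
    profiles in \<open>D\<close> are dense.\<close>
  have convD: "convex_fun_on (D i) (\<lambda>y. f i (w(i := y)))"
    if i: "i \<in> ?N" and w: "w \<in> PiE (?O i) E" for i w
  proof (rule convex_fun_on_dense[where T = "?To i" and P = "PiE (?O i) D"])
    have "E j \<subseteq> ?S j closure_of D j" if "j \<in> ?O i" for j
    proof -
      have j: "j \<in> ?N" using that ON by blast
      show ?thesis using EclD[OF j] DE[OF j]
        by (simp add: closure_of_subtopology_subset closure_of_subtopology inf_absorb2)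
    qed
    then show "topspace (?To i) \<subseteq> ?To i closure_of PiE (?O i) D"
      unfolding topTo unfolding profile_topology_def closure_of_product_topology by (intro PiE_mono)
    show "lsc_on (?To i) (topspace (?To i)) (\<lambda>w. f i (w(i := y)))" if "y \<in> D i" for y
      unfolding topTo using lsc_y[OF i] DE[OF i] that by blast
    show "usc_on (?To i) (topspace (?To i)) (\<lambda>w. f i (w(i := y)))" if "y \<in> D i" for y
      unfolding topTo by (rule assms(6)[OF i that])
    show "convex_fun_on (D i) (\<lambda>y. f i (v(i := y)))" if "v \<in> PiE (?O i) D" for v
      by (rule assms(8)[OF i that])
    show "w \<in> topspace (?To i)" unfolding topTo by (rule w)
  qed
  have convex: "convex_on (E i) (\<lambda>y. f i (x(i := y)))"
    if i: "i \<in> ?N" and x: "x \<in> PiE ?N E" for i x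
  proof -
    note w = restr[OF x, of i]
    from convex_on_self_segment_dense[OF tvs[OF i] haus[OF i] ssd[OF i] lsc_w[OF i w] assms(7)[OF i w] convD[OF i w]]
    show ?thesis by (simp add: upd[OF x i])
  qed
  have approx: "\<exists>z\<in>D i. f i (x(i := z)) < f i (x(i := y)) + e"
    if i: "i \<in> ?N" and x: "x \<in> PiE ?N E" and y: "y \<in> E i" and e: "0 < e" for i x y e
  proof -
    have "y \<in> topspace (?S i)" using y topS[OF i] by simp
    from dense_usc_approx[OF ssd[OF i] assms(7)[OF i restr[OF x]] openin_topspace this e]
    show ?thesis by (auto simp: upd[OF x i])
  qed
  define G where "G y =
      {x \<in> PiE ?N E. (\<Sum>i\<in>?N. f i x) \<le> (\<Sum>i\<in>?N. f i (x(i := y i)))}" for y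
  have closedG: "closedin ?T (G y)" if y: "y \<in> PiE ?N D" for y
  proof -
    let ?g = "\<lambda>x. (\<Sum>i\<in>?N. f i x + - f i (x(i := y i)))"
    have "lsc_on ?T (topspace ?T) ?g"
    proof (intro lsc_on_sum lsc_on_add)
      fix i assume i: "i \<in> ?N"
      show "lsc_on ?T (topspace ?T) (f i)" by (rule lscT[OF i])
      \<comment> \<open>Once the strategy of \<open>i\<close> is frozen, the loss depends on
        \<open>x\<close> only through the opponents, hence factors through the restriction
        map.\<close>
      have "usc_on (?To i) (topspace (?To i)) (\<lambda>w. f i (w(i := y i)))"
        unfolding topTo by (rule assms(6)[OF i]) (use y i in blast)
      from usc_on_compose[OF this continuous_map_profile_restrict[OF ON]]
      have "usc_on ?T (topspace ?T) (\<lambda>x. f i ((restrict x (?O i))(i := y i)))" .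
      then have "usc_on ?T (topspace ?T) (\<lambda>x. f i (x(i := y i)))"
        by (rule usc_on_cong[rotated]) (simp only: topT upd i)
      then show "lsc_on ?T (topspace ?T) (\<lambda>x. - f i (x(i := y i)))"
        by (simp add: usc_on_iff_lsc_on_uminus)
    qed simp
    from openin_lsc_superlevel[OF this, of 0]
    have "openin ?T {x \<in> topspace ?T. 0 < ?g x}" .
    moreover have "G y = topspace ?T - {x \<in> topspace ?T. 0 < ?g x}"
      unfolding G_def topT sum.distrib sum_negf by auto
    ultimately show ?thesis by auto
  qed
  have "\<exists>x. \<forall>y\<in>PiE ?N D. x \<in> G y"
  proof (rule kkm_compact_space[OF compT _ closedG])
    show "PiE ?N D \<noteq> {}" using Dne by (simp add: PiE_eq_empty_iff)
    fix m and ys :: "nat \<Rightarrow> nat \<Rightarrow> 'a"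
    assume m: "0 < m" and ys: "\<And>k. k < m \<Longrightarrow> ys k \<in> PiE ?N D"
    \<comment> \<open>Coordinatewise convex combinations. They may leave the sets \<open>D i\<close>
      but stay in the convex sets \<open>E i\<close>.\<close>
    let ?A = "(\<lambda>m ys l. \<lambda>i\<in>?N. \<Sum>k<m. l k *\<^sub>R ys k i) :: nat \<Rightarrow> (nat \<Rightarrow> nat \<Rightarrow> 'a) \<Rightarrow> (nat \<Rightarrow> real) \<Rightarrow> nat \<Rightarrow> 'a"
    have ysE: "ys k i \<in> E i" if "k < m" "i \<in> ?N" for k i
      using ys[OF that(1)] DE[OF that(2)] that(2) by blast
    have inE: "(\<Sum>k<m. l k *\<^sub>R ys k i) \<in> E i"
      if "l \<in> nat_simplex m" "i \<in> ?N" for l i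
      using that ysE convE by (intro convex_sum) (auto simp: nat_simplex_def)
    have "continuous_map (top_of_set (nat_simplex m)) ?T (?A m ys)"
      unfolding profile_topology_def continuous_map_componentwise
    proof (intro conjI ballI)
      fix i assume i: "i \<in> ?N"
      have "continuous_map (top_of_set (nat_simplex m)) (X i) (\<lambda>l. \<Sum>k<m. l k *\<^sub>R ys k i)"
      proof (intro tvs_continuous_map_sum tvs_continuous_map_scaleR tvs[OF i])
        fix k assume "k \<in> {..<m}"
        then show "continuous_map (top_of_set (nat_simplex m)) (X i) (\<lambda>l. ys k i)"
          using ysE[of k i] i EX[OF i] by auto
        show "continuous_map (top_of_set (nat_simplex m)) euclideanreal (\<lambda>l. l k)"
          using continuous_on_subset[OF continuous_on_product_coordinates] by auto
      qed
      then show "continuous_map (top_of_set (nat_simplex m)) (?S i) (\<lambda>l. ?A m ys l i)"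
        using inE i by (auto simp: continuous_map_in_subtopology)
    qed auto
    moreover have "\<exists>k<m. 0 < l k \<and> ?A m ys l \<in> G (ys k)"
      if l: "l \<in> nat_simplex m" for l
    proof (rule ccontr)
      assume no: "\<not> ?thesis"
      define x where "x = ?A m ys l"
      have x: "x \<in> PiE ?N E" using inE[OF l] by (auto simp: x_def)
      have l': "\<And>k. k < m \<Longrightarrow> 0 \<le> l k" "(\<Sum>k<m. l k) = 1"
        using l by (auto simp: nat_simplex_def)
      \<comment> \<open>If the covering condition fails, every vertex of positive weight has
        \<open>?v k\<close> below the total loss at \<open>x\<close>. Convexity in each own strategy
        bounds that loss by the weighted average of the \<open>?v k\<close>, a
        contradiction.\<close>
      let ?v = "\<lambda>k. \<Sum>i\<in>?N. f i (x(i := ys k i))"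
      have v: "?v k < (\<Sum>i\<in>?N. f i x)" if "k < m" "0 < l k" for k
        using no that x by (auto simp: G_def x_def not_le)
      have "(\<Sum>i\<in>?N. f i x) \<le> (\<Sum>i\<in>?N. \<Sum>k<m. l k * f i (x(i := ys k i)))"
      proof (rule sum_mono)
        fix i assume i: "i \<in> ?N"
        have "f i (x(i := \<Sum>k<m. l k *\<^sub>R ys k i)) \<le> (\<Sum>k<m. l k * f i (x(i := ys k i)))"
          using convex_on_sum[OF _ _ convex[OF i x], of "{..<m}" l "\<lambda>k. ys k i"] m l' ysE i
            by auto
        moreover have "x(i := \<Sum>k<m. l k *\<^sub>R ys k i) = x" using i by (auto simp: x_def)
        ultimately show "f i x \<le> (\<Sum>k<m. l k * f i (x(i := ys k i)))" by simp
      qed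
      also have "\<dots> = (\<Sum>k<m. l k * ?v k)"
        by (subst sum.swap) (simp add: sum_distrib_left)
      also have "\<dots> < (\<Sum>k<m. l k * (\<Sum>i\<in>?N. f i x))"
      proof (rule sum_strict_mono_ex1)
        show "\<forall>k\<in>{..<m}. l k * ?v k \<le> l k * (\<Sum>i\<in>?N. f i x)"
          using v l'(1) by (metis lessThan_iff less_eq_real_def mult_left_mono mult_zero_left)
        \<comment> \<open>The weights sum to 1, so one of them is positive and makes the comparison
          strict.\<close>
        obtain k where "k < m" "0 < l k"
          using l' by (metis lessThan_iff less_eq_real_def sum.neutral zero_neq_one)
        then show "\<exists>k\<in>{..<m}. l k * ?v k < l k * (\<Sum>i\<in>?N. f i x)"
          using v by (intro bexI[of _ k] mult_strict_left_mono) auto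
      qed simp
      also have "\<dots> = (\<Sum>i\<in>?N. f i x)"
        using l'(2) by (simp add: sum_distrib_right[symmetric])
      finally show False by simp
    qed
    ultimately show "continuous_map (top_of_set (nat_simplex m)) ?T (?A m ys) \<and>
      (\<forall>l\<in>nat_simplex m. \<exists>k<m. 0 < l k \<and> ?A m ys l \<in> G (ys k))" by blast
  qed
  then obtain x where x: "\<And>y. y \<in> PiE ?N D \<Longrightarrow> x \<in> G y" by blast
  have xE: "x \<in> PiE ?N E"
  proof -
    obtain y where "y \<in> PiE ?N D" using Dne by (metis PiE_eq_empty_iff ex_in_conv)
    then show ?thesis using x by (auto simp: G_def)
  qed
  have "nash_equilibrium n E f x"
  proof (rule nash_equilibriumI[OF xE])
    fix i y assume i: "i \<in> ?N" and y: "y \<in> E i"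
    show "f i x \<le> f i (x(i := y))"
    proof (rule ccontr)
      assume less: "\<not> ?thesis"
      \<comment> \<open>The gain of the deviation is shared among the \<open>n\<close> players, so
        that the \<open>n\<close> approximation errors add up to exactly that gain.\<close>
      define e where "e = (f i x - f i (x(i := y))) / n"
      \<comment> \<open>Target strategies to be approximated from \<open>D\<close>: the deviation
        for \<open>i\<close>, the current strategy for everyone else.\<close>
      define t where "t = x(i := y)"
      have e: "0 < e" using less assms(1) by (simp add: e_def)
      have "\<forall>j\<in>?N. \<exists>z. z \<in> D j \<and> f j (x(j := z)) < f j (x(j := t j)) + e"
      proof
        fix j assume j: "j \<in> ?N"
        have "t j \<in> E j" using xE j y by (auto simp: t_def)
        from approx[OF j xE this e] show "\<exists>z. z \<in> D j \<and> f j (x(j := z)) < f j (x(j := t j)) + e"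
          by blast
      qed
      then obtain z where z: "\<And>j. j \<in> ?N \<Longrightarrow> z j \<in> D j \<and> f j (x(j := z j)) < f j (x(j := t j)) + e"
        by metis
      have "(\<Sum>j\<in>?N. f j x) \<le> (\<Sum>j\<in>?N. f j (x(j := restrict z ?N j)))"
        using x[of "restrict z ?N"] z by (auto simp: G_def)
      also have "\<dots> < (\<Sum>j\<in>?N. f j (x(j := t j)) + e)"
        using z i by (intro sum_strict_mono) auto
      also have "\<dots> = (\<Sum>j\<in>?N. f j (x(j := t j))) + n * e" by (simp add: sum.distrib)
      \<comment> \<open>For \<open>j\<close> other than \<open>i\<close> the update by
        \<open>t j\<close> leaves \<open>x\<close> unchanged, so only the term of \<open>i\<close>
        differs.\<close>
      also have "(\<Sum>j\<in>?N. f j (x(j := t j))) = f i (x(i := y)) + (\<Sum>j\<in>?N - {i}. f j x)"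
        using i by (subst sum.remove[of _ i]) (auto simp: t_def intro!: sum.cong)
      also have "\<dots> + n * e = (\<Sum>j\<in>?N. f j x)"
        using i assms(1) by (subst (2) sum.remove[of _ i]) (auto simp: e_def)
      finally show False by simp
    qed
  qed
  then show ?thesis by blast
qed

end
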